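(* Let $m\ge 2$, $s\ge 1$ and let $X_1,\dots,X_m\in\mathbb{Z}^s$ (not necessarily distinct) span $\mathbb{R}^s$, and suppose they are $\eta$-coplanar for some $\eta\in\mathbb{R}^s$, i.e. $\langle\eta,X_j\rangle=1$ for $j=1,\dots,m$. Let $\gamma$ be the directional growth function of $\mathcal{J}=X_1\mathbb{N}+\dots+X_m\mathbb{N}$ (see context). Then for every unit vector $\theta$ in the cone $\mathbf{C}_X=X_1\mathbb{R}^++\dots+X_m\mathbb{R}^+$, $$\gamma(\theta)=\langle\theta,\eta\rangle\,\sup\Big\{h(p):\ p=(p_1,\dots,p_m)\text{ a probability vector},\ p_1X_1+\dots+p_mX_m=\frac{\theta}{\langle\theta,\eta\rangle}\Big\},$$ where $h(p)=-\sum_{j=1}^m p_j\log p_j$.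
   Context: $\mathbb{N}=\{0,1,2,\dots\}$. For $z\in\mathcal{J}$, $\mathbf{m}(z)$ is the number of finite words $i_1\cdots i_n$ ($n\ge0$, $i_k\in\{1,\dots,m\}$) with $X_{i_1}+\dots+X_{i_n}=z$; for $x\in\mathbf{C}_X$, $\mathbf{m}(x)=\min\{\mathbf{m}(z):z\in\mathcal{J},\ \|x-z\|=d(x,\mathcal{J})\}$ (Euclidean norm). The directional growth function is $\gamma(\theta)=\lim_{k\to\infty}\frac{\log\mathbf{m}(k\theta)}{k}$ for unit $\theta\in\mathbf{C}_X$ (this limit exists). *)

theory Defs
  imports "HOL-Analysis.Analysis"
begin

definition semigroup_J :: "('m::finite \<Rightarrow> real ^ 's) \<Rightarrow> (real ^ 's) set" where
  "semigroup_J X = {(\<Sum>j\<in>UNIV. real (n j) *\<^sub>R X j) | n :: 'm \<Rightarrow> nat. True}"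

definition cone_C :: "('m::finite \<Rightarrow> real ^ 's) \<Rightarrow> (real ^ 's) set" where
  "cone_C X = {(\<Sum>j\<in>UNIV. c j *\<^sub>R X j) | c :: 'm \<Rightarrow> real. \<forall>j. 0 \<le> c j}"

definition coplanar_wrt :: "real ^ 's \<Rightarrow> ('m::finite \<Rightarrow> real ^ 's) \<Rightarrow> bool" where
  "coplanar_wrt \<eta> X \<longleftrightarrow> (\<forall>j. \<eta> \<bullet> X j = 1)"

definition word_count :: "('m::finite \<Rightarrow> real ^ 's) \<Rightarrow> real ^ 's \<Rightarrow> nat" where
  "word_count X z = card {w :: 'm list. sum_list (map X w) = z}"

text \<open>
  Coplanarity makes the set of words counted above finite, so its \<^const>\<open>card\<close> is
  the true number of words.
\<close>

lemma finite_words: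
  fixes X :: "'m::finite \<Rightarrow> real ^ 's"
  assumes "coplanar_wrt \<eta> X"
  shows "finite {w :: 'm list. sum_list (map X w) = z}"
proof -
  have len: "\<eta> \<bullet> sum_list (map X w) = real (length w)" for w
    using assms by (induction w) (auto simp: coplanar_wrt_def inner_add_right)
  have "{w. sum_list (map X w) = z} \<subseteq> {w. set w \<subseteq> UNIV \<and> length w = nat \<lfloor>\<eta> \<bullet> z\<rfloor>}"
    using len by auto
  then show ?thesis
    by (rule finite_subset) (rule finite_lists_length_eq, simp)
qed

text \<open>
  The minimum of \<^const>\<open>word_count\<close> over the points of the semigroup nearest to \<open>x\<close>; the
  \<^const>\<open>Inf\<close> of a nonempty set of naturals is its minimum. For integral generators nearest
  points exist, since the semigroup is then closed.
\<close>

definition nearest_word_count :: "('m::finite \<Rightarrow> real ^ 's) \<Rightarrow> real ^ 's \<Rightarrow> nat" where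
  "nearest_word_count X x =
     Inf (word_count X ` {z \<in> semigroup_J X. norm (x - z) = infdist x (semigroup_J X)})"

definition growth_seq :: "('m::finite \<Rightarrow> real ^ 's) \<Rightarrow> real ^ 's \<Rightarrow> nat \<Rightarrow> real" where
  "growth_seq X \<theta> k = ln (real (nearest_word_count X (real k *\<^sub>R \<theta>))) / real k"

definition directional_growth :: "('m::finite \<Rightarrow> real ^ 's) \<Rightarrow> real ^ 's \<Rightarrow> real" where
  "directional_growth X \<theta> = lim (growth_seq X \<theta>)"

definition prob_vector :: "('m::finite \<Rightarrow> real) \<Rightarrow> bool" where
  "prob_vector p \<longleftrightarrow> (\<forall>j. 0 \<le> p j) \<and> (\<Sum>j\<in>UNIV. p j) = 1"

text \<open>The summand at \<open>p j = 0\<close> is 0, the usual convention for entropy.\<close>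

definition entropy_h :: "('m::finite \<Rightarrow> real) \<Rightarrow> real" where
  "entropy_h p = - (\<Sum>j\<in>UNIV. p j * ln (p j))"

end

theory Submission
  imports Defs "HOL-Combinatorics.Multiset_Permutations" "HOL-Real_Asymp.Real_Asymp"
begin

text \<open>
  A semigroup point \<open>z\<close> nearest to \<open>k \<theta>\<close> lies within a distance of it that does not depend on \<open>k\<close>. By
  coplanarity all words with sum \<open>z\<close> have the same length \<open>N = \<langle>\<eta>, z\<rangle>\<close>. Grouping them by letter counts
  gives polynomially many classes, and the class of \<open>n\<close> has \<open>exp (N h(n / N))\<close> elements up to a
  polynomial factor. Since \<open>z / N\<close> tends to \<open>\<theta> / \<langle>\<theta>, \<eta>\<rangle>\<close>, compactness of the simplex and continuity
  of \<open>h\<close> bound the growth from above by the supremum. Conversely, for every admissible \<open>p\<close> and all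
  large \<open>k\<close>, the point \<open>z\<close> has a representation \<open>z = n\<^sub>1 X\<^sub>1 + \<dots> + n\<^sub>m X\<^sub>m\<close> with \<open>n - k \<langle>\<theta>, \<eta>\<rangle> p\<close>
  bounded, so its class alone gives the growth \<open>\<langle>\<theta>, \<eta>\<rangle> h(p)\<close>.
\<close>

section \<open>Stirling-type bounds for factorials and the entropy of nonnegative vectors\<close>

lemma mult_ln_Suc_diff_le_1: "real n * (ln (real n + 1) - ln (real n)) \<le> 1"
proof (cases "n = 0")
  case False
  have "ln (real n + 1) - ln (real n) = ln (1 + 1 / real n)"
    using False by (subst ln_divide_pos[symmetric]) (auto simp: field_simps)
  also have "\<dots> \<le> 1 / real n" by (rule ln_add_one_self_le_self) simp
  finally show ?thesis using False by (simp add: field_simps)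
qed simp

text \<open>From \<open>n\<close> to \<open>n + 1\<close> the left side grows by
  \<open>ln (n + 1)\<close> plus \<open>n * (ln (n + 1) - ln n) - 1\<close>, and the latter is at
  most 0. The gap to the upper bound is only logarithmic, so it vanishes once logarithms of counts
  are divided by \<open>k\<close>.\<close>

lemma ln_fact_lower: "real n * ln (real n) - real n \<le> ln (fact n)"
proof (induction n)
  case (Suc n)
  have "ln (fact (Suc n) :: real) = ln (real n + 1) + ln (fact n)"
    by (simp add: ln_mult add.commute)
  then show ?case using Suc mult_ln_Suc_diff_le_1[of n] by (simp add: algebra_simps)
qed simp

lemma ln_fact_upper: "ln (fact n) \<le> real n * ln (real n) - real n + (ln (real n + 1) + 1)"
proof -
  \<comment> \<open>This form passes through the induction: its increment exceeds
    \<open>ln (n + 1)\<close> by \<open>(n + 2) * (ln (n + 2) - ln (n + 1)) - 1\<close>, which is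
    nonnegative. The stated bound follows by trading \<open>n * ln (n + 1)\<close> for
    \<open>n * ln n + 1\<close>.\<close>
  have "ln (fact n :: real) \<le> (real n + 1) * ln (real n + 1) - real n"
  proof (induction n)
    case (Suc n)
    have "ln (1 - 1 / (real n + 2)) \<le> - (1 / (real n + 2))"
      using ln_le_minus_one[of "1 - 1 / (real n + 2)"] by (simp add: field_simps)
    moreover have "ln (1 - 1 / (real n + 2)) = ln (real n + 1) - ln (real n + 2)"
      by (subst ln_divide_pos[symmetric]) (auto simp: field_simps)
    ultimately have "1 / (real n + 2) \<le> ln (real n + 2) - ln (real n + 1)"
      by linarith
    then have "(real n + 2) * (ln (real n + 2) - ln (real n + 1)) \<ge> 1"
      by (simp add: field_simps)
    moreover have "ln (fact (Suc n) :: real) = ln (real n + 1) + ln (fact n)"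
      by (simp add: ln_mult add.commute)
    ultimately show ?case using Suc by (simp add: algebra_simps)
  qed simp
  with mult_ln_Suc_diff_le_1[of n] show ?thesis by (simp add: algebra_simps)
qed

text \<open>The degree-one homogeneous extension of \<^const>\<open>entropy_h\<close> to nonnegative vectors: for a count
  vector \<open>n\<close> with total \<open>N\<close> it is \<open>N h(n / N)\<close>, the leading term of the log multinomial coefficient.\<close>

definition mass_entropy :: "('m::finite \<Rightarrow> real) \<Rightarrow> real" where
  "mass_entropy c = (\<Sum>j\<in>UNIV. c j) * ln (\<Sum>j\<in>UNIV. c j) - (\<Sum>j\<in>UNIV. c j * ln (c j))"

lemma mass_entropy_prob_vector: "prob_vector p \<Longrightarrow> mass_entropy p = entropy_h p"
  by (simp add: mass_entropy_def entropy_h_def prob_vector_def)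

text \<open>Scaling adds to each term \<open>x * ln x\<close> a multiple of \<open>x\<close> with
  the common factor \<open>s * ln s\<close>; these contributions cancel between the total and the
  sum over the letters.\<close>

lemma mass_entropy_scale:
  fixes c :: "'m::finite \<Rightarrow> real"
  assumes "0 < s" "\<And>j. 0 \<le> c j"
  shows "mass_entropy (\<lambda>j. s * c j) = s * mass_entropy c"
proof -
  have *: "s * x * ln (s * x) = s * (x * ln x) + s * ln s * x" if "0 \<le> x" for x
    using that assms(1) by (cases "x = 0") (auto simp: ln_mult algebra_simps)
  have nn: "0 \<le> (\<Sum>j\<in>UNIV. c j)" using assms(2) by (simp add: sum_nonneg)
  show ?thesis
    unfolding mass_entropy_def sum_distrib_left[symmetric] *[OF nn] *[OF assms(2)]
    by (simp add: sum.distrib sum_distrib_left[symmetric] algebra_simps)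
qed

lemma continuous_on_x_ln_x: "continuous_on {0..} (\<lambda>x::real. x * ln x)"
proof -
  \<comment> \<open>At the boundary point the value \<open>0 * ln 0 = 0\<close> agrees with the
    limit from the right.\<close>
  have "((\<lambda>x::real. x * ln x) \<longlongrightarrow> 0 * ln 0) (at 0 within {0..})"
  proof -
    have "((\<lambda>x::real. x * ln x) \<longlongrightarrow> 0) (at_right 0)" by real_asymp
    then show ?thesis by (simp add: at_within_Ici_at_right)
  qed
  moreover have "((\<lambda>x::real. x * ln x) \<longlongrightarrow> x * ln x) (at x within {0..})" if "x > 0" for x
    using that by (intro tendsto_intros) auto
  ultimately show ?thesis
    unfolding continuous_on_def by (metis atLeast_iff order_le_less)
qed

lemma tendsto_mass_entropy:
  fixes c :: "'m::finite \<Rightarrow> real"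
  assumes lim: "\<And>j. ((\<lambda>k. f k j) \<longlongrightarrow> c j) F"
    and nn: "\<And>k j. 0 \<le> f k j" "\<And>j. 0 \<le> c j"
  shows "((\<lambda>k. mass_entropy (f k)) \<longlongrightarrow> mass_entropy c) F"
proof -
  have "((\<lambda>k. g k * ln (g k)) \<longlongrightarrow> a * ln a) F"
    if "(g \<longlongrightarrow> a) F" "\<And>k. 0 \<le> g k" "0 \<le> a" for g and a :: real
    using continuous_on_tendsto_compose[OF continuous_on_x_ln_x that(1)] that by simp
  note this[intro]
  show ?thesis
    unfolding mass_entropy_def
    by (intro tendsto_diff tendsto_sum) (auto intro!: lim nn tendsto_sum sum_nonneg)
qed

section \<open>Counting words by their letter counts\<close>

lemma size_eq_sum_count: "size A = (\<Sum>j\<in>UNIV. count A j)" for A :: "'m::finite multiset"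
  unfolding size_multiset_overloaded_eq
  by (rule sum.mono_neutral_left) (auto simp: not_in_iff)

text \<open>The cardinality is a multinomial coefficient. The upper estimate spends the logarithmic
  error once, on the factorial of the size; the lower one spends it on the factorial of each letter
  count, whence the factor \<open>CARD('m)\<close>.\<close>

lemma ln_card_permutations_of_multiset:
  fixes A :: "'m::finite multiset"
  defines "n \<equiv> \<lambda>j. real (count A j)"
  shows "ln (card (permutations_of_multiset A)) \<le> mass_entropy n + (ln (real (size A) + 1) + 1)"
    and "mass_entropy n - CARD('m) * (ln (real (size A) + 1) + 1)
           \<le> ln (card (permutations_of_multiset A))"
proof -
  have size: "real (size A) = (\<Sum>j\<in>UNIV. n j)"
    by (simp add: n_def size_eq_sum_count)
  \<comment> \<open>Absent letters contribute \<open>fact 0 = 1\<close>, so the product may run over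
    the whole alphabet.\<close>
  have "card (permutations_of_multiset A) * (\<Prod>j\<in>UNIV. fact (count A j)) = fact (size A)"
    by (subst prod.mono_neutral_right[of UNIV "set_mset A"])
       (auto simp: not_in_iff card_permutations_of_multiset_aux simp del: One_nat_def)
  then have "real (card (permutations_of_multiset A)) * (\<Prod>j\<in>UNIV. fact (count A j)) = fact (size A)"
    by (metis (mono_tags, lifting) of_nat_fact of_nat_mult of_nat_prod prod.cong)
  moreover have "real (card (permutations_of_multiset A)) > 0"
    by (simp add: card_gt_0_iff)
  moreover have "(\<Prod>j\<in>UNIV. fact (count A j) :: real) > 0" by (simp add: prod_pos)
  ultimately have eq: "ln (card (permutations_of_multiset A)) =
      ln (fact (size A)) - (\<Sum>j\<in>UNIV. ln (fact (count A j)))"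
    by (simp add: ln_mult_pos flip: ln_prod) (metis add_diff_cancel_right' ln_mult_pos of_nat_0_less_iff)
  \<comment> \<open>The linear terms cancel because the letter counts add up to the size; they are
    inserted to match the shape of the factorial bounds.\<close>
  have H: "mass_entropy n = real (size A) * ln (real (size A)) - real (size A) 
     - (\<Sum>j\<in>UNIV. n j * ln (n j) - n j)"
    unfolding mass_entropy_def size by (simp add: sum_subtractf)
  have "(\<Sum>j\<in>UNIV. n j * ln (n j) - n j) \<le> (\<Sum>j\<in>UNIV. ln (fact (count A j)))"
    unfolding n_def by (intro sum_mono ln_fact_lower)
  then show "ln (card (permutations_of_multiset A)) \<le> mass_entropy n + (ln (real (size A) + 1) + 1)"
    using ln_fact_upper[of "size A"] unfolding eq H by linarith
  have "(\<Sum>j\<in>UNIV. ln (fact (count A j))) \<le>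
      (\<Sum>j\<in>UNIV. (n j * ln (n j) - n j) + (ln (real (size A) + 1) + 1))"
  proof (rule sum_mono)
    fix j
    have "count A j \<le> size A" by (rule count_le_size)
    then show "ln (fact (count A j)) \<le> (n j * ln (n j) - n j) + (ln (real (size A) + 1) + 1)"
      unfolding n_def by (intro order_trans[OF ln_fact_upper]) simp
  qed
  then show "mass_entropy n - CARD('m) * (ln (real (size A) + 1) + 1)
           \<le> ln (card (permutations_of_multiset A))"
    using ln_fact_lower[of "size A"] unfolding eq H sum.distrib by (simp add: distrib_left)
qed

lemma sum_list_map_eq_sum_count_scaleR:
  fixes X :: "'m::finite \<Rightarrow> 'a::real_vector"
  shows "sum_list (map X w) = (\<Sum>j\<in>UNIV. real (count (mset w) j) *\<^sub>R X j)"
proof (induction w)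
  case (Cons a w)
  have "(\<Sum>j\<in>UNIV. real (count (mset (a # w)) j) *\<^sub>R X j) =
     (\<Sum>j\<in>UNIV. real (count (mset w) j) *\<^sub>R X j + (if j = a then X a else 0))"
    by (intro sum.cong) (auto simp: algebra_simps)
  then show ?case using Cons by (simp add: sum.distrib)
qed simp

lemma coplanar_length:
  assumes "coplanar_wrt \<eta> X"
  shows "\<eta> \<bullet> sum_list (map X w) = real (length w)"
  using assms by (induction w) (auto simp: coplanar_wrt_def inner_add_right)

text \<open>Each count lies between 0 and \<open>N\<close>. This crude bound is enough: it is
  polynomial in \<open>N\<close>, so its logarithm is negligible against \<open>k\<close>.\<close>

lemma card_multisets_of_size_le:
  "card {A :: 'm::finite multiset. size A = N} \<le> (N + 1) ^ CARD('m)"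
  "finite {A :: 'm::finite multiset. size A = N}"
proof -
  let ?S = "{A :: 'm multiset. size A = N}" and ?F = "PiE (UNIV :: 'm set) (\<lambda>_. {..N})"
  have inj: "inj_on count ?S" by (simp add: inj_on_def multiset_eq_iff)
  have sub: "count ` ?S \<subseteq> ?F" by (auto simp: PiE_iff count_le_size)
  have fin: "finite ?F" by (intro finite_PiE) auto
  show "finite ?S" using inj sub fin by (meson finite_imageD finite_subset)
  have "card ?S \<le> card ?F" using card_inj_on_le[OF inj sub fin] .
  then show "card ?S \<le> (N + 1) ^ CARD('m)" by (simp add: card_PiE)
qed

text \<open>Of the \<open>CARD('m) + 1\<close> error terms, \<open>CARD('m)\<close> pay for the
  number of rearrangement classes and one for the factorial estimate within a class.\<close>

lemma ln_word_count_le: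
  fixes X :: "'m::finite \<Rightarrow> real ^ 's"
  assumes cop: "coplanar_wrt \<eta> X" and N: "\<eta> \<bullet> z = real N" and ne: "word_count X z \<noteq> 0"
    and ub: "\<And>w. sum_list (map X w) = z \<Longrightarrow> mass_entropy (\<lambda>j. real (count (mset w) j)) \<le> b"
  shows "ln (word_count X z) \<le> (real CARD('m) + 1) * (ln (real N + 1) + 1) + b"
proof -
  let ?W = "{w. sum_list (map X w) = z}" and ?b = "exp (b + (ln (real N + 1) + 1))"
  have len: "length w = N" if "w \<in> ?W" for w
    using coplanar_length[OF cop, of w] that N by simp
  have fin: "finite (mset ` ?W)"
    by (rule finite_subset[OF _ card_multisets_of_size_le(2)[of N]]) (use len in auto)
  have "?W \<subseteq> (\<Union>A\<in>mset ` ?W. permutations_of_multiset A)"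
    by (auto simp: permutations_of_multiset_def)
  then have "card ?W \<le> card (\<Union>A\<in>mset ` ?W. permutations_of_multiset A)"
    using fin by (intro card_mono finite_UN_I) auto
  also have "\<dots> \<le> (\<Sum>A\<in>mset ` ?W. card (permutations_of_multiset A))"
    by (rule card_UN_le[OF fin])
  finally have "real (word_count X z) \<le> (\<Sum>A\<in>mset ` ?W. real (card (permutations_of_multiset A)))"
    unfolding word_count_def by (simp flip: of_nat_sum)
  also have "\<dots> \<le> (\<Sum>A\<in>mset ` ?W. ?b)"
  proof (rule sum_mono)
    fix A assume "A \<in> mset ` ?W"
    then obtain w where w: "w \<in> ?W" "A = mset w" by auto
    have "ln (card (permutations_of_multiset A)) \<le> b + (ln (real N + 1) + 1)"
      using ln_card_permutations_of_multiset(1)[of A] ub[of w] w len[of w] by simp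
    moreover have "card (permutations_of_multiset A) > 0" by (simp add: card_gt_0_iff)
    ultimately show "real (card (permutations_of_multiset A)) \<le> ?b"
      by (metis exp_le_cancel_iff exp_ln of_nat_0_less_iff)
  qed
  also have "\<dots> \<le> (real N + 1) ^ CARD('m) * ?b"
  proof -
    have "card (mset ` ?W) \<le> card {A :: 'm multiset. size A = N}"
      by (rule card_mono[OF card_multisets_of_size_le(2)]) (use len in auto)
    also note card_multisets_of_size_le(1)
    finally have "real (card (mset ` ?W)) \<le> real ((N + 1) ^ CARD('m))" by (simp only: of_nat_le_iff)
    then show ?thesis by (simp add: add.commute)
  qed
  finally have "ln (word_count X z) \<le> ln ((real N + 1) ^ CARD('m) * ?b)"
    using ne by (subst ln_le_cancel_iff) auto
  also have "\<dots> = CARD('m) * ln (real N + 1) + (b + (ln (real N + 1) + 1))"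
    by (subst ln_mult) (auto simp: ln_realpow)
  also have "\<dots> \<le> (real CARD('m) + 1) * (ln (real N + 1) + 1) + b"
    by (simp add: algebra_simps)
  finally show ?thesis .
qed

lemma ex_word_with_counts:
  fixes n :: "'m::finite \<Rightarrow> nat"
  shows "\<exists>w. count (mset w) = n"
proof -
  obtain w where "mset w = (\<Sum>j\<in>UNIV. replicate_mset (n j) j)" using ex_mset by blast
  then have "count (mset w) = n" by (auto simp: count_sum)
  then show ?thesis ..
qed

lemma semigroup_J_eq_word_sums:
  fixes X :: "'m::finite \<Rightarrow> real ^ 's"
  shows "semigroup_J X = range (\<lambda>w. sum_list (map X w))"
proof safe
  fix z assume "z \<in> semigroup_J X"
  then obtain n :: "'m \<Rightarrow> nat" where "z = (\<Sum>j\<in>UNIV. real (n j) *\<^sub>R X j)"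
    by (auto simp: semigroup_J_def)
  moreover obtain w where "count (mset w) = n" using ex_word_with_counts by blast
  ultimately have "z = sum_list (map X w)" by (simp add: sum_list_map_eq_sum_count_scaleR)
  then show "z \<in> range (\<lambda>w. sum_list (map X w))" by blast
next
  fix w show "sum_list (map X w) \<in> semigroup_J X"
    unfolding sum_list_map_eq_sum_count_scaleR semigroup_J_def by blast
qed

lemma ln_word_count_ge:
  fixes X :: "'m::finite \<Rightarrow> real ^ 's" and n :: "'m \<Rightarrow> nat"
  assumes cop: "coplanar_wrt \<eta> X" and N: "\<eta> \<bullet> z = real N"
    and n: "(\<Sum>j\<in>UNIV. real (n j) *\<^sub>R X j) = z"
  shows "mass_entropy (\<lambda>j. real (n j)) - CARD('m) * (ln (real N + 1) + 1) \<le> ln (word_count X z)"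
proof -
  obtain w where w: "count (mset w) = n" using ex_word_with_counts by blast
  let ?A = "mset w"
  have sum: "sum_list (map X v) = z" if "mset v = ?A" for v
    unfolding sum_list_map_eq_sum_count_scaleR that w by (rule n)
  have size: "size ?A = N"
    using coplanar_length[OF cop, of w] sum[of w] N by simp
  have "card (permutations_of_multiset ?A) \<le> word_count X z"
    unfolding word_count_def
    by (rule card_mono[OF finite_words[OF cop]]) (auto simp: permutations_of_multiset_def sum)
  moreover have "card (permutations_of_multiset ?A) > 0" by (simp add: card_gt_0_iff)
  ultimately have "ln (card (permutations_of_multiset ?A)) \<le> ln (word_count X z)"
    by simp
  then show ?thesis
    using ln_card_permutations_of_multiset(2)[of ?A] unfolding w size by linarith
qed

section \<open>Integral points near the ray and their representations\<close>

lemma scaled_limit_of_bounded_deviation: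
  fixes f :: "nat \<Rightarrow> 'a::real_normed_vector"
  assumes "\<forall>\<^sub>F k in sequentially. norm (f k - real k *\<^sub>R a) \<le> C"
  shows "(\<lambda>k. f k /\<^sub>R real k) \<longlonglongrightarrow> a"
proof -
  have "(\<lambda>k. f k /\<^sub>R real k - a) \<longlonglongrightarrow> 0"
  proof (rule Lim_null_comparison)
    show "\<forall>\<^sub>F k in sequentially. norm (f k /\<^sub>R real k - a) \<le> C / real k"
      using assms eventually_gt_at_top[of 0]
    proof eventually_elim
      case (elim k)
      have "f k /\<^sub>R real k - a = (f k - real k *\<^sub>R a) /\<^sub>R real k"
        using elim by (simp add: scaleR_diff_right)
      then have "norm (f k /\<^sub>R real k - a) = norm (f k - real k *\<^sub>R a) / real k"
        by (simp add: divide_inverse_commute)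
      also have "\<dots> \<le> C / real k" using elim by (intro divide_right_mono) auto
      finally show ?case .
    qed
    show "(\<lambda>k. C / real k) \<longlonglongrightarrow> 0" by real_asymp
  qed
  then show ?thesis by (simp add: LIM_zero_iff)
qed

lemma finite_bounded_integral_vectors:
  "finite {e :: real ^ 's. (\<forall>i. e $ i \<in> \<int>) \<and> norm e \<le> B}"
proof -
  let ?F = "PiE (UNIV :: 's set) (\<lambda>_. of_int ` {- \<lceil>B\<rceil>..\<lceil>B\<rceil>} :: real set)"
  have "{e :: real ^ 's. (\<forall>i. e $ i \<in> \<int>) \<and> norm e \<le> B} \<subseteq> vec_lambda ` ?F"
  proof
    fix e :: "real ^ 's" assume e: "e \<in> {e. (\<forall>i. e $ i \<in> \<int>) \<and> norm e \<le> B}"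
    have "e $ i \<in> of_int ` {- \<lceil>B\<rceil>..\<lceil>B\<rceil>}" for i
    proof -
      obtain a where a: "e $ i = of_int a" using e by (auto elim: Ints_cases)
      have "\<bar>of_int a\<bar> \<le> B" using component_le_norm_cart[of e i] e a by simp
      then have "a \<in> {- \<lceil>B\<rceil>..\<lceil>B\<rceil>}" by (auto; linarith)
      then show ?thesis using a by auto
    qed
    then have "vec_nth e \<in> ?F" by auto
    moreover have "e = vec_lambda (vec_nth e)" by simp
    ultimately show "e \<in> vec_lambda ` ?F" by blast
  qed
  moreover have "finite ?F" by (intro finite_PiE) auto
  ultimately show ?thesis by (meson finite_imageI finite_subset)
qed

lemma semigroup_J_integral:
  assumes "\<forall>j i. X j $ i \<in> \<int>" "z \<in> semigroup_J X"
  shows "z $ i \<in> \<int>"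
  using assms by (auto simp: semigroup_J_def intro!: Ints_sum Ints_mult)

text \<open>Distinct integral points differ by at least 1 in some coordinate, so the semigroup is
  uniformly discrete.\<close>

lemma closed_semigroup_J:
  fixes X :: "'m::finite \<Rightarrow> real ^ 's"
  assumes X: "\<forall>j i. X j $ i \<in> \<int>"
  shows "closed (semigroup_J X)"
proof (rule discrete_imp_closed[of 1])
  show "\<forall>x\<in>semigroup_J X. \<forall>y\<in>semigroup_J X. dist y x < 1 \<longrightarrow> y = x"
  proof (intro ballI impI)
    fix x y assume xy: "x \<in> semigroup_J X" "y \<in> semigroup_J X" "dist y x < 1"
    have "y $ i = x $ i" for i
    proof -
      have "\<bar>y $ i - x $ i\<bar> < 1"
        using component_le_norm_cart[of "y - x" i] xy(3) by (simp add: dist_norm)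
      moreover have "y $ i - x $ i \<in> \<int>"
        using xy semigroup_J_integral[OF X] by (auto intro: Ints_diff)
      ultimately show ?thesis using Ints_nonzero_abs_less1[of "y $ i - x $ i"] by simp
    qed
    then show "y = x" by (simp add: vec_eq_iff)
  qed
qed simp

lemma norm_sum_floor_le:
  fixes X :: "'m::finite \<Rightarrow> 'a::real_normed_vector"
  assumes "\<And>j. 0 \<le> c j"
  shows "norm ((\<Sum>j\<in>UNIV. c j *\<^sub>R X j) - (\<Sum>j\<in>UNIV. real (nat \<lfloor>c j\<rfloor>) *\<^sub>R X j)) \<le> (\<Sum>j\<in>UNIV. norm (X j))"
proof -
  have "norm (c j *\<^sub>R X j - real (nat \<lfloor>c j\<rfloor>) *\<^sub>R X j) \<le> norm (X j)" for j
  proof -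
    have "\<bar>c j - real (nat \<lfloor>c j\<rfloor>)\<bar> \<le> 1" using assms[of j] by linarith
    then show ?thesis by (simp add: mult_left_le_one_le flip: scaleR_diff_left)
  qed
  then show ?thesis by (simp add: sum_norm_le flip: sum_subtractf)
qed

text \<open>Rounding down the cone coefficients of \<open>x\<close> gives a semigroup point at a
  distance bounded independently of \<open>x\<close>, and a nearest point is no farther away.
  Closedness makes the set of nearest points nonempty, so the \<open>Inf\<close> is a true
  minimum.\<close>

lemma nearest_word_count_attained:
  fixes X :: "'m::finite \<Rightarrow> real ^ 's"
  assumes X: "\<forall>j i. X j $ i \<in> \<int>" and x: "x \<in> cone_C X"
  obtains z where "z \<in> semigroup_J X" "nearest_word_count X x = word_count X z"
    "norm (x - z) \<le> (\<Sum>j\<in>UNIV. norm (X j))"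
proof -
  let ?J = "semigroup_J X" and ?K = "{z \<in> semigroup_J X. norm (x - z) = infdist x (semigroup_J X)}"
  obtain c where c: "\<And>j. 0 \<le> c j" "x = (\<Sum>j\<in>UNIV. c j *\<^sub>R X j)"
    using x by (auto simp: cone_C_def)
  let ?a = "\<Sum>j\<in>UNIV. real (nat \<lfloor>c j\<rfloor>) *\<^sub>R X j"
  have a: "?a \<in> ?J" unfolding semigroup_J_def mem_Collect_eq by (intro exI[of _ "\<lambda>j. nat \<lfloor>c j\<rfloor>"]) simp
  have "infdist x ?J \<le> norm (x - ?a)"
    using infdist_le[OF a] by (simp add: dist_norm)
  also have "\<dots> \<le> (\<Sum>j\<in>UNIV. norm (X j))"
    unfolding c(2) by (rule norm_sum_floor_le[OF c(1)])
  finally have le: "infdist x ?J \<le> (\<Sum>j\<in>UNIV. norm (X j))" .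
  obtain y where "y \<in> ?J" "infdist x ?J = dist x y"
    using infdist_attains_inf[OF closed_semigroup_J[OF X]] a by blast
  then have "y \<in> ?K" by (simp add: dist_norm)
  then have "?K \<noteq> {}" by blast
  then have "nearest_word_count X x \<in> word_count X ` ?K"
    unfolding nearest_word_count_def by (intro Inf_nat_def1) auto
  then show thesis using that le by auto
qed

lemma bounded_deviation_representation:
  fixes X :: "'m::finite \<Rightarrow> real ^ 's" and z :: "nat \<Rightarrow> real ^ 's"
  assumes X: "\<forall>j i. X j $ i \<in> \<int>" and c: "\<And>j. 0 \<le> c j"
    and z: "\<And>k. z k \<in> semigroup_J X"
    and B: "\<And>k. norm (real k *\<^sub>R (\<Sum>j\<in>UNIV. c j *\<^sub>R X j) - z k) \<le> B"
  obtains n :: "nat \<Rightarrow> 'm \<Rightarrow> nat" and C where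
    "\<forall>\<^sub>F k in sequentially. (\<Sum>j\<in>UNIV. real (n k j) *\<^sub>R X j) = z k
       \<and> (\<forall>j. \<bar>real (n k j) - real k * c j\<bar> \<le> C)"
proof -
  define l where "l k j = nat \<lfloor>real k * c j\<rfloor>" for k j
  define e where "e k = z k - (\<Sum>j\<in>UNIV. real (l k j) *\<^sub>R X j)" for k
  \<comment> \<open>The rounding error \<open>e k\<close> takes finitely many values, and any representation of \<open>z k\<close> shows that its
    error is an integer combination with nonnegative coefficients off the support of \<open>c\<close>. Fixing one
    such combination per error value makes the corrections to \<open>l k\<close> bounded, and on the support of
    \<open>c\<close> they are eventually absorbed by \<open>l k\<close>.\<close>
  define P where "P a u \<longleftrightarrow> (\<Sum>j\<in>UNIV. real_of_int (u j) *\<^sub>R X j) = a \<and> (\<forall>j. c j = 0 \<longrightarrow> 0 \<le> u j)"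
    for a :: "real ^ 's" and u :: "'m \<Rightarrow> int"
  define u where "u a = (SOME v. P a v)" for a
  let ?R = "{a :: real ^ 's. (\<forall>i. a $ i \<in> \<int>) \<and> norm a \<le> B + (\<Sum>j\<in>UNIV. norm (X j))}"
  have e: "e k \<in> ?R" for k
  proof -
    have "e k $ i \<in> \<int>" for i
      using semigroup_J_integral[OF X z] X
      by (auto simp: e_def intro!: Ints_diff Ints_sum Ints_mult)
    moreover have "norm (e k) \<le> B + (\<Sum>j\<in>UNIV. norm (X j))"
    proof -
      let ?x = "real k *\<^sub>R (\<Sum>j\<in>UNIV. c j *\<^sub>R X j)" and ?y = "\<Sum>j\<in>UNIV. real (l k j) *\<^sub>R X j"
      have "norm (?x - ?y) \<le> (\<Sum>j\<in>UNIV. norm (X j))"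
        using norm_sum_floor_le[of "\<lambda>j. real k * c j" X] c by (simp add: l_def scaleR_sum_right)
      moreover have "e k = (?x - ?y) - (?x - z k)" by (simp add: e_def)
      ultimately show ?thesis using B[of k] norm_triangle_ineq4[of "?x - ?y" "?x - z k"] by simp
    qed
    ultimately show ?thesis by simp
  qed
  have l_zero: "l k j = 0" if "c j = 0" for k j using that by (simp add: l_def)
  have u: "P (e k) (u (e k))" for k
  proof -
    obtain n :: "'m \<Rightarrow> nat" where n: "z k = (\<Sum>j\<in>UNIV. real (n j) *\<^sub>R X j)"
      using z[of k] by (auto simp: semigroup_J_def)
    have "P (e k) (\<lambda>j. int (n j) - int (l k j))"
      by (simp add: P_def e_def n l_zero scaleR_diff_left sum_subtractf)
    then show ?thesis unfolding u_def by (metis someI)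
  qed
  \<comment> \<open>Summing over all possible error values, of which there are finitely many, makes
    the bound independent of \<open>k\<close>.\<close>
  define C where "C = (\<Sum>a\<in>?R. \<Sum>j\<in>UNIV. \<bar>u a j\<bar>)"
  have C: "\<bar>u (e k) j\<bar> \<le> C" for k j
  proof -
    have "\<bar>u (e k) j\<bar> \<le> (\<Sum>j\<in>UNIV. \<bar>u (e k) j\<bar>)"
      by (rule member_le_sum) auto
    also have "\<dots> \<le> C"
      unfolding C_def by (rule member_le_sum[OF e _ finite_bounded_integral_vectors]) (auto intro: sum_nonneg)
    finally show ?thesis .
  qed
  have "\<forall>\<^sub>F k in sequentially. 0 \<le> int (l k j) + u (e k) j" for j
  proof (cases "c j = 0")
    case True
    then show ?thesis using u by (simp add: P_def)
  next
    case False
    then have "0 < c j" using c[of j] by simp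
    then have "\<forall>\<^sub>F k in sequentially. real k * c j \<ge> real_of_int C + 1" by real_asymp
    then show ?thesis
    proof eventually_elim
      case (elim k)
      then have "C \<le> int (l k j)" unfolding l_def by linarith
      then show ?case using C[of k j] by linarith
    qed
  qed
  then have nonneg: "\<forall>\<^sub>F k in sequentially. \<forall>j. 0 \<le> int (l k j) + u (e k) j"
    by (rule eventually_all_finite)
  have "\<forall>\<^sub>F k in sequentially. (\<Sum>j\<in>UNIV. real (nat (int (l k j) + u (e k) j)) *\<^sub>R X j) = z k
       \<and> (\<forall>j. \<bar>real (nat (int (l k j) + u (e k) j)) - real k * c j\<bar> \<le> real_of_int C + 1)"
    using nonneg
  proof eventually_elim
    case (elim k)
    have cast: "real (nat (int (l k j) + u (e k) j)) = real (l k j) + real_of_int (u (e k) j)" for j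
      using elim by simp
    have "(\<Sum>j\<in>UNIV. real_of_int (u (e k) j) *\<^sub>R X j) = e k" using u[of k] by (simp add: P_def)
    then have "(\<Sum>j\<in>UNIV. real (nat (int (l k j) + u (e k) j)) *\<^sub>R X j) = z k"
      unfolding cast scaleR_add_left sum.distrib by (simp add: e_def)
    \<comment> \<open>The correction \<open>u (e k)\<close> accounts for \<open>C\<close>, the
      rounding in \<open>l k\<close> for the extra 1.\<close>
    moreover have "\<bar>real (nat (int (l k j) + u (e k) j)) - real k * c j\<bar> \<le> real_of_int C + 1" for j
    proof -
      have "\<bar>real (l k j) - real k * c j\<bar> \<le> 1"
        using c[of j] mult_nonneg_nonneg[of "real k" "c j"] unfolding l_def by linarith
      moreover have "\<bar>real_of_int (u (e k) j)\<bar> \<le> real_of_int C" using C[of k j] by linarith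
      ultimately show ?thesis unfolding cast by linarith
    qed
    ultimately show ?case by blast
  qed
  then show thesis using that[of "\<lambda>k j. nat (int (l k j) + u (e k) j)"] by blast
qed

section \<open>Compactness of the simplex and the two growth bounds\<close>

lemma bdd_above_entropy_h: "bdd_above (entropy_h ` Collect prob_vector)"
proof (rule bdd_aboveI2)
  fix p :: "'a \<Rightarrow> real" assume "p \<in> Collect prob_vector"
  then have p: "\<And>j. 0 \<le> p j" by (auto simp: prob_vector_def)
  have "- (p j * ln (p j)) \<le> 1" for j
  proof (cases "p j = 0")
    case False
    then have pos: "0 < p j" using p[of j] by simp
    then have "- ln (p j) \<le> 1 / p j - 1"
      using ln_le_minus_one[of "1 / p j"] by (simp add: ln_div)
    then have "p j * (- ln (p j)) \<le> p j * (1 / p j - 1)" using pos by (intro mult_left_mono) auto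
    also have "\<dots> \<le> 1" using pos by (simp add: algebra_simps)
    finally show ?thesis by simp
  qed simp
  then have "(\<Sum>j\<in>UNIV. - (p j * ln (p j))) \<le> (\<Sum>j\<in>(UNIV :: 'a set). 1)" by (intro sum_mono)
  then show "entropy_h p \<le> real CARD('a)" by (simp add: entropy_h_def sum_negf)
qed

text \<open>This is a continuous image of a compact part of the simplex. Closedness lets a target
  outside the set exclude all nearby points as well, which replaces the extraction of convergent
  subsequences.\<close>

lemma closed_entropy_superlevel_image:
  fixes X :: "'m::finite \<Rightarrow> real ^ 's"
  shows "closed {\<Sum>j\<in>UNIV. p j *\<^sub>R X j | p. prob_vector p \<and> b \<le> entropy_h p}"
proof -
  \<comment> \<open>Functions are turned into vectors of \<open>real ^ 'm\<close>, where closed and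
    bounded sets are compact.\<close>
  let ?D = "{q :: real ^ 'm. prob_vector (vec_nth q)}"
  have "closed ?D"
    unfolding prob_vector_def
    by (intro closed_Collect_conj closed_positive_orthant closed_Collect_eq continuous_intros)
  moreover have "bounded ?D"
  proof (rule boundedI)
    fix q assume "q \<in> ?D"
    then have "(\<Sum>j\<in>UNIV. \<bar>q $ j\<bar>) = 1" by (simp add: prob_vector_def)
    then show "norm q \<le> 1" using norm_le_l1_cart[of q] by simp
  qed
  ultimately have D: "compact ?D" by (simp add: compact_eq_bounded_closed)
  have "continuous_on ?D (\<lambda>q. q $ j * ln (q $ j))" for j
    by (rule continuous_on_compose2[OF continuous_on_x_ln_x])
       (auto intro!: continuous_intros simp: prob_vector_def)
  then have "continuous_on ?D (\<lambda>q. entropy_h (vec_nth q))"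
    unfolding entropy_h_def by (intro continuous_on_minus continuous_on_sum)
  then have "closed {q \<in> ?D. b \<le> entropy_h (vec_nth q)}"
    by (intro continuous_on_closed_Collect_le continuous_on_const \<open>closed ?D\<close>)
  then have "compact (?D \<inter> {q \<in> ?D. b \<le> entropy_h (vec_nth q)})"
    using D by (intro compact_Int_closed)
  then have "compact ((\<lambda>q. \<Sum>j\<in>UNIV. q $ j *\<^sub>R X j) ` (?D \<inter> {q \<in> ?D. b \<le> entropy_h (vec_nth q)}))"
    by (intro compact_continuous_image continuous_intros)
  also have "(\<lambda>q. \<Sum>j\<in>UNIV. q $ j *\<^sub>R X j) ` (?D \<inter> {q \<in> ?D. b \<le> entropy_h (vec_nth q)}) =
      {\<Sum>j\<in>UNIV. p j *\<^sub>R X j | p. prob_vector p \<and> b \<le> entropy_h p}"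
  proof safe
    fix p :: "'m \<Rightarrow> real" assume "prob_vector p" "b \<le> entropy_h p"
    then show "(\<Sum>j\<in>UNIV. p j *\<^sub>R X j) \<in>
        (\<lambda>q. \<Sum>j\<in>UNIV. q $ j *\<^sub>R X j) ` (?D \<inter> {q \<in> ?D. b \<le> entropy_h (vec_nth q)})"
      by (intro image_eqI[of _ _ "vec_lambda p"]) (auto simp: vec_lambda_inverse)
  qed auto
  finally show ?thesis by (rule compact_imp_closed)
qed


text \<open>No probability vector of entropy at least \<open>s\<close> represents
  \<open>\<theta> /\<^sub>R \<tau>\<close>, hence eventually none represents
  \<open>z k /\<^sub>R real (N k)\<close>. The letter frequencies of every word with sum
  \<open>z k\<close> then have entropy below \<open>s\<close>, which bounds all classes at
  once.\<close>

lemma word_count_growth_less: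
  fixes X :: "'m::finite \<Rightarrow> real ^ 's" and z :: "nat \<Rightarrow> real ^ 's"
  assumes cop: "coplanar_wrt \<eta> X" and z: "\<And>k. z k \<in> semigroup_J X"
    and N: "\<And>k. \<eta> \<bullet> z k = real (N k)"
    and limz: "(\<lambda>k. z k /\<^sub>R real k) \<longlonglongrightarrow> \<theta>" and limN: "(\<lambda>k. real (N k) / real k) \<longlonglongrightarrow> \<tau>"
    and limL: "(\<lambda>k. (ln (real (N k) + 1) + 1) / real k) \<longlonglongrightarrow> 0"
    and \<tau>: "0 < \<tau>"
    and sup: "\<And>p. prob_vector p \<Longrightarrow> (\<Sum>j\<in>UNIV. p j *\<^sub>R X j) = \<theta> /\<^sub>R \<tau> \<Longrightarrow> entropy_h p < s"
    and b: "\<tau> * s < b"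
  shows "\<forall>\<^sub>F k in sequentially. ln (word_count X (z k)) / real k < b"
proof -
  let ?K = "{\<Sum>j\<in>UNIV. p j *\<^sub>R X j | p. prob_vector p \<and> s \<le> entropy_h p}"
  have Npos: "\<forall>\<^sub>F k in sequentially. 0 < real (N k) / real k"
    using limN \<tau> by (rule order_tendstoD)
  have lim: "(\<lambda>k. (z k /\<^sub>R real k) /\<^sub>R (real (N k) / real k)) \<longlonglongrightarrow> \<theta> /\<^sub>R \<tau>"
    using \<tau> by (intro tendsto_intros limz limN) auto
  have "\<theta> /\<^sub>R \<tau> \<in> - ?K" using sup by (force simp: not_le)
  with lim have ev: "\<forall>\<^sub>F k in sequentially. (z k /\<^sub>R real k) /\<^sub>R (real (N k) / real k) \<in> - ?K"
    by (rule topological_tendstoD[OF _ open_Compl[OF closed_entropy_superlevel_image]])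
  have bound: "\<forall>\<^sub>F k in sequentially. ln (word_count X (z k)) / real k \<le>
      (real CARD('m) + 1) * ((ln (real (N k) + 1) + 1) / real k) + real (N k) / real k * s"
    using ev Npos
  proof eventually_elim
    case (elim k)
    \<comment> \<open>Division by zero yields 0, so positivity of the quotient also rules out
      \<open>k = 0\<close>.\<close>
    then have pos: "0 < real k" "0 < real (N k)" by (auto simp: zero_less_divide_iff)
    have "(z k /\<^sub>R real k) /\<^sub>R (real (N k) / real k) = z k /\<^sub>R real (N k)"
      using pos by (simp add: field_simps)
    then have zN: "z k /\<^sub>R real (N k) \<notin> ?K" using elim(1) by (simp only: Compl_iff not_False_eq_True)
    have "mass_entropy (\<lambda>j. real (count (mset w) j)) \<le> real (N k) * s" if w: "sum_list (map X w) = z k" for w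
    proof -
      define p where "p j = real (count (mset w) j) / real (N k)" for j
      have "real (N k) = real (length w)" using coplanar_length[OF cop, of w] N[of k] w by simp
      also have "\<dots> = (\<Sum>j\<in>UNIV. real (count (mset w) j))"
        using size_eq_sum_count[of "mset w"] by (simp flip: of_nat_sum)
      finally have p: "prob_vector p"
        using pos unfolding prob_vector_def p_def sum_divide_distrib[symmetric] by simp
      have "(\<Sum>j\<in>UNIV. p j *\<^sub>R X j) = z k /\<^sub>R real (N k)"
        unfolding w[symmetric] sum_list_map_eq_sum_count_scaleR p_def
        by (simp add: scaleR_sum_right divide_inverse_commute)
      then have "entropy_h p < s" using zN p unfolding mem_Collect_eq by (metis not_le)
      moreover have "mass_entropy (\<lambda>j. real (N k) * p j) = real (N k) * entropy_h p"
        using pos p by (subst mass_entropy_scale) (auto simp: mass_entropy_prob_vector prob_vector_def)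
      moreover have "(\<lambda>j. real (N k) * p j) = (\<lambda>j. real (count (mset w) j))"
        using pos by (simp add: p_def)
      ultimately show ?thesis using pos by simp
    qed
    moreover have "word_count X (z k) \<noteq> 0"
      using z[of k] by (auto simp: semigroup_J_eq_word_sums word_count_def card_eq_0_iff finite_words[OF cop])
    ultimately have "ln (word_count X (z k)) \<le> (real CARD('m) + 1) * (ln (real (N k) + 1) + 1) + real (N k) * s"
      by (intro ln_word_count_le[OF cop N])
    then have "ln (word_count X (z k)) / real k \<le>
       ((real CARD('m) + 1) * (ln (real (N k) + 1) + 1) + real (N k) * s) / real k"
      by (rule divide_right_mono) simp
    then show ?case by (simp only: add_divide_distrib[of "_ * _"] times_divide_eq_left times_divide_eq_right)
  qed
  have "(\<lambda>k. (real CARD('m) + 1) * ((ln (real (N k) + 1) + 1) / real k) + real (N k) / real k * s)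
      \<longlonglongrightarrow> (real CARD('m) + 1) * 0 + \<tau> * s"
    by (intro tendsto_intros limL limN)
  then have "\<forall>\<^sub>F k in sequentially.
      (real CARD('m) + 1) * ((ln (real (N k) + 1) + 1) / real k) + real (N k) / real k * s < b"
    using b by (intro order_tendstoD) auto
  with bound show ?thesis by eventually_elim linarith
qed

text \<open>The coefficients \<open>\<tau> * p j\<close> represent \<open>\<theta>\<close>, and
  integer representations of \<open>z k\<close> at bounded distance from their \<open>k\<close>-fold
  multiples exist even if some \<open>p j\<close> vanish. One class then suffices, by homogeneity
  and continuity of \<open>mass_entropy\<close>.\<close>

lemma word_count_growth_greater:
  fixes X :: "'m::finite \<Rightarrow> real ^ 's" and z :: "nat \<Rightarrow> real ^ 's"
  assumes X: "\<forall>j i. X j $ i \<in> \<int>" and cop: "coplanar_wrt \<eta> X" and z: "\<And>k. z k \<in> semigroup_J X"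
    and N: "\<And>k. \<eta> \<bullet> z k = real (N k)"
    and B: "\<And>k. norm (real k *\<^sub>R \<theta> - z k) \<le> B"
    and limL: "(\<lambda>k. (ln (real (N k) + 1) + 1) / real k) \<longlonglongrightarrow> 0"
    and \<tau>: "0 < \<tau>" and p: "prob_vector p" "(\<Sum>j\<in>UNIV. p j *\<^sub>R X j) = \<theta> /\<^sub>R \<tau>"
    and a: "a < \<tau> * entropy_h p"
  shows "\<forall>\<^sub>F k in sequentially. a < ln (word_count X (z k)) / real k"
proof -
  define c where "c j = \<tau> * p j" for j
  have c: "0 \<le> c j" for j using \<tau> p by (simp add: c_def prob_vector_def)
  have "(\<Sum>j\<in>UNIV. c j *\<^sub>R X j) = \<tau> *\<^sub>R (\<Sum>j\<in>UNIV. p j *\<^sub>R X j)"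
    by (simp add: c_def scaleR_sum_right)
  then have \<theta>: "(\<Sum>j\<in>UNIV. c j *\<^sub>R X j) = \<theta>" using p \<tau> by simp
  obtain n :: "nat \<Rightarrow> 'm \<Rightarrow> nat" and C where
    n: "\<forall>\<^sub>F k in sequentially. (\<Sum>j\<in>UNIV. real (n k j) *\<^sub>R X j) = z k
       \<and> (\<forall>j. \<bar>real (n k j) - real k * c j\<bar> \<le> C)"
    using bounded_deviation_representation[of X c z B] X c z B \<theta> by auto
  have "(\<lambda>k. real (n k j) /\<^sub>R real k) \<longlonglongrightarrow> c j" for j
    by (rule scaled_limit_of_bounded_deviation, rule eventually_mono[OF n]) auto
  then have "(\<lambda>k. mass_entropy (\<lambda>j. real (n k j) /\<^sub>R real k)) \<longlonglongrightarrow> mass_entropy c"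
    using c by (intro tendsto_mass_entropy) auto
  moreover have "mass_entropy c = \<tau> * entropy_h p"
    unfolding c_def using \<tau> p
    by (subst mass_entropy_scale) (auto simp: mass_entropy_prob_vector prob_vector_def)
  ultimately have "(\<lambda>k. mass_entropy (\<lambda>j. real (n k j) /\<^sub>R real k)
      - real CARD('m) * ((ln (real (N k) + 1) + 1) / real k)) \<longlonglongrightarrow> \<tau> * entropy_h p - real CARD('m) * 0"
    by (intro tendsto_diff tendsto_mult tendsto_const limL) simp
  then have "\<forall>\<^sub>F k in sequentially. a < mass_entropy (\<lambda>j. real (n k j) /\<^sub>R real k)
      - real CARD('m) * ((ln (real (N k) + 1) + 1) / real k)"
    using a by (intro order_tendstoD) auto
  with n eventually_gt_at_top[of 0] show ?thesis
  proof eventually_elim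
    case (elim k)
    have "mass_entropy (\<lambda>j. real (n k j) /\<^sub>R real k) = mass_entropy (\<lambda>j. real (n k j)) / real k"
      using elim(2) mass_entropy_scale[of "inverse (real k)" "\<lambda>j. real (n k j)"]
      by (simp add: divide_inverse_commute)
    moreover have "(mass_entropy (\<lambda>j. real (n k j)) - real CARD('m) * (ln (real (N k) + 1) + 1)) / real k
        \<le> ln (word_count X (z k)) / real k"
      using elim(1) by (intro divide_right_mono ln_word_count_ge[OF cop N]) auto
    ultimately show ?case using elim(3) by (simp add: diff_divide_distrib)
  qed
qed

section \<open>Existence and value of the growth limit\<close>

theorem theorem1p3:
  fixes X :: "'m::finite \<Rightarrow> real ^ 's" and \<eta> \<theta> :: "real ^ 's"
  assumes "CARD('m) \<ge> 2"
    and "\<forall>j i. X j $ i \<in> \<int>"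
    and "span (range X) = UNIV"
    and "coplanar_wrt \<eta> X"
    and "\<theta> \<in> cone_C X"
    and "norm \<theta> = 1"
  shows "convergent (growth_seq X \<theta>) \<and>
    directional_growth X \<theta> =
      (\<theta> \<bullet> \<eta>) * Sup {entropy_h p | p.
        prob_vector p \<and> (\<Sum>j\<in>UNIV. p j *\<^sub>R X j) = (1 / (\<theta> \<bullet> \<eta>)) *\<^sub>R \<theta>}"
proof -
  note X = assms(2) and cop = assms(4)
  define \<tau> where "\<tau> = \<theta> \<bullet> \<eta>"
  define S where "S = {entropy_h p | p. prob_vector p \<and> (\<Sum>j\<in>UNIV. p j *\<^sub>R X j) = \<theta> /\<^sub>R \<tau>}"
  obtain c where c: "\<And>j. 0 \<le> c j" "\<theta> = (\<Sum>j\<in>UNIV. c j *\<^sub>R X j)"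
    using assms(5) by (auto simp: cone_C_def)
  \<comment> \<open>Pairing with \<open>\<eta>\<close> reads off the total mass of \<open>c\<close>,
    so \<open>\<tau> = 0\<close> would force \<open>\<theta> = 0\<close>.\<close>
  have \<tau>_sum: "\<tau> = (\<Sum>j\<in>UNIV. c j)"
    using cop by (simp add: \<tau>_def c(2) inner_sum_right inner_commute[of _ \<eta>] coplanar_wrt_def)
  have "\<tau> \<noteq> 0"
  proof
    assume "\<tau> = 0"
    then have "c j = 0" for j using c(1) by (simp add: \<tau>_sum sum_nonneg_eq_0_iff)
    then show False using c(2) assms(6) by simp
  qed
  moreover have "0 \<le> \<tau>" unfolding \<tau>_sum using c(1) by (simp add: sum_nonneg)
  ultimately have \<tau>: "0 < \<tau>" by simp
  have "prob_vector (\<lambda>j. c j / \<tau>)"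
    using c(1) \<tau> by (simp add: prob_vector_def \<tau>_sum flip: sum_divide_distrib)
  moreover have "(\<Sum>j\<in>UNIV. (c j / \<tau>) *\<^sub>R X j) = \<theta> /\<^sub>R \<tau>"
    by (simp add: c(2) scaleR_sum_right divide_inverse_commute)
  \<comment> \<open>Nonemptiness and boundedness of \<open>S\<close> make the real-valued
    \<open>Sup\<close> a genuine supremum.\<close>
  ultimately have S_ne: "S \<noteq> {}" unfolding S_def by blast
  have S_bdd: "bdd_above S"
    by (rule bdd_above_mono[OF bdd_above_entropy_h]) (auto simp: S_def)
  have "real k *\<^sub>R \<theta> \<in> cone_C X" for k
    unfolding cone_C_def mem_Collect_eq c(2) scaleR_sum_right
    using c(1) by (intro exI[of _ "\<lambda>j. real k * c j"]) simp
  then have "\<exists>z. z \<in> semigroup_J X \<and> nearest_word_count X (real k *\<^sub>R \<theta>) = word_count X z \<and>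
      norm (real k *\<^sub>R \<theta> - z) \<le> (\<Sum>j\<in>UNIV. norm (X j))" for k
    using nearest_word_count_attained[OF X] by metis
  then obtain z where z: "\<And>k. z k \<in> semigroup_J X"
    and nearest: "\<And>k. nearest_word_count X (real k *\<^sub>R \<theta>) = word_count X (z k)"
    and B: "\<And>k. norm (real k *\<^sub>R \<theta> - z k) \<le> (\<Sum>j\<in>UNIV. norm (X j))"
    by metis
  have growth: "growth_seq X \<theta> = (\<lambda>k. ln (word_count X (z k)) / real k)"
    by (simp add: growth_seq_def nearest fun_eq_iff)
  have "\<exists>N. \<eta> \<bullet> z k = real N" for k
    using z[of k] coplanar_length[OF cop] by (auto simp: semigroup_J_eq_word_sums)
  then obtain N where N: "\<And>k. \<eta> \<bullet> z k = real (N k)" by metis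
  have limz: "(\<lambda>k. z k /\<^sub>R real k) \<longlonglongrightarrow> \<theta>"
    using B by (intro scaled_limit_of_bounded_deviation[of _ _ "\<Sum>j\<in>UNIV. norm (X j)"] always_eventually)
      (simp add: norm_minus_commute)
  then have "(\<lambda>k. \<eta> \<bullet> (z k /\<^sub>R real k)) \<longlonglongrightarrow> \<eta> \<bullet> \<theta>" by (intro tendsto_intros)
  then have limN: "(\<lambda>k. real (N k) / real k) \<longlonglongrightarrow> \<tau>"
    by (simp add: N \<tau>_def inner_commute divide_inverse_commute)
  have limL: "(\<lambda>k. (ln (real (N k) + 1) + 1) / real k) \<longlonglongrightarrow> 0"
  proof -
    have inv: "(\<lambda>k. 1 / real k) \<longlonglongrightarrow> 0" and lnk: "(\<lambda>k. (ln (real k) + 1) / real k) \<longlonglongrightarrow> 0"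
      by real_asymp+
    \<comment> \<open>Factoring \<open>k\<close> out of \<open>N k + 1\<close> splits its logarithm
      into \<open>ln k\<close> and a convergent term, both negligible after division by
      \<open>k\<close>.\<close>
    have "(\<lambda>k. ln (real (N k) / real k + 1 / real k) * (1 / real k) + (ln (real k) + 1) / real k)
        \<longlonglongrightarrow> ln (\<tau> + 0) * 0 + 0"
      using \<tau> by (intro tendsto_intros limN inv lnk) auto
    moreover have "\<forall>\<^sub>F k in sequentially.
        ln (real (N k) / real k + 1 / real k) * (1 / real k) + (ln (real k) + 1) / real k
        = (ln (real (N k) + 1) + 1) / real k"
      using eventually_gt_at_top[of 0]
    proof eventually_elim
      case (elim k)
      then have "ln (real (N k) / real k + 1 / real k) = ln (real (N k) + 1) - ln (real k)"
        by (subst ln_divide_pos[symmetric]) (auto simp: add_divide_distrib)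
      then show ?case by (simp add: diff_divide_distrib add_divide_distrib)
    qed
    ultimately show ?thesis by (simp add: tendsto_cong)
  qed
  have "growth_seq X \<theta> \<longlonglongrightarrow> \<tau> * Sup S"
    unfolding growth
  proof (rule order_tendstoI)
    fix a assume "a < \<tau> * Sup S"
    then have "a / \<tau> < Sup S" using \<tau> by (simp add: field_simps)
    then obtain p where p: "prob_vector p" "(\<Sum>j\<in>UNIV. p j *\<^sub>R X j) = \<theta> /\<^sub>R \<tau>" "a / \<tau> < entropy_h p"
      using less_cSupD[OF S_ne] unfolding S_def by blast
    then have "a < \<tau> * entropy_h p" using \<tau> by (simp add: field_simps)
    then show "\<forall>\<^sub>F k in sequentially. a < ln (word_count X (z k)) / real k"
      by (intro word_count_growth_greater[OF X cop z N B limL \<tau> p(1,2)])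
  next
    fix b assume "\<tau> * Sup S < b"
    then have "Sup S < b / \<tau>" using \<tau> by (simp add: field_simps)
    \<comment> \<open>The supremum may be attained, so a strictly larger threshold is inserted to
      obtain the strict inequality for every admissible \<open>p\<close>.\<close>
    then obtain s where s: "Sup S < s" "s < b / \<tau>" using dense by blast
    have "entropy_h p < s" if "prob_vector p" "(\<Sum>j\<in>UNIV. p j *\<^sub>R X j) = \<theta> /\<^sub>R \<tau>" for p
    proof -
      have "entropy_h p \<in> S" using that by (auto simp: S_def)
      then show ?thesis using cSup_upper[OF _ S_bdd] s(1) by fastforce
    qed
    moreover have "\<tau> * s < b" using s \<tau> by (simp add: field_simps)
    ultimately show "\<forall>\<^sub>F k in sequentially. ln (word_count X (z k)) / real k < b"
      by (intro word_count_growth_less[OF cop z N limz limN limL \<tau>])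
  qed
  then show ?thesis
    by (simp add: convergent_def directional_growth_def limI S_def \<tau>_def divide_inverse exI)
qed

end
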